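(* Let $n\geq 1$ and $1\leq k\leq n$ be integers, let $\lambda_1,\ldots,\lambda_n>0$ and $\gamma>0$. Let $X_1,\ldots,X_n$ be independent exponential random variables with rates $\lambda_1,\ldots,\lambda_n$ respectively, and let $Y_1,\ldots,Y_n$ be independent exponential random variables with common rate $\gamma$. Let $X_{k:n}$ and $Y_{k:n}$ denote the $k$th order statistics of the two samples. Then $Y_{k:n}\leq_* X_{k:n}$.
   Context: An exponential random variable with rate $\lambda>0$ has distribution function $1-e^{-\lambda x}$, $x\geq 0$. The $k$th order statistic of a sample of size $n$ is its $k$th smallest value (so $X_{1:n}$ is the minimum and $X_{n:n}$ the maximum). Star order: for random variables $U$ and $V$ supported on $(0,\infty)$ with distribution functions $F$ and $G$ respectively, $U\leq_* V$ means that $G^{-1}(F(x))/x$ is increasing (in the weak sense) in $x>0$, where $G^{-1}$ denotes the right continuous inverse of $G$. Equivalently, for each $c>0$, $F(cx)$ crosses $G(x)$ at most once, and from below, as $x$ increases on $(0,\infty)$. The order depends only on the distributions of $U$ and $V$. *)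

theory Defs
  imports "HOL-Probability.Probability"
begin

text \<open>
  The sample is indexed by \<open>{1..n}\<close> and \<open>k\<close> ranges over \<open>1 \<le> k \<le> n\<close>;
  list positions start at 0, hence the index \<open>k - 1\<close>.
\<close>

definition order_stat :: "(nat \<Rightarrow> 'a \<Rightarrow> real) \<Rightarrow> nat \<Rightarrow> nat \<Rightarrow> 'a \<Rightarrow> real" where
  "order_stat X n k \<omega> = sort (map (\<lambda>i. X i \<omega>) [1..<Suc n]) ! (k - 1)"

definition dist_fun :: "'a measure \<Rightarrow> ('a \<Rightarrow> real) \<Rightarrow> real \<Rightarrow> real" where
  "dist_fun M U = cdf (distr M borel U)"

text \<open>
  The strict inequality makes the generalized inverse right continuous. It is extended-real
  valued, so that it equals \<open>\<infinity>\<close> where \<open>G\<close> never exceeds \<open>u\<close> (an infimum in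
  \<open>real\<close> over the empty set would be an unspecified number).
\<close>

definition rc_inverse :: "(real \<Rightarrow> real) \<Rightarrow> real \<Rightarrow> ereal" where
  "rc_inverse G u = (INF y\<in>{y. u < G y}. ereal y)"

text \<open>
  Star order \<open>U \<le>\<^sub>* V\<close>. The two variables may live on different spaces, as only their
  distributions matter. The order is restricted to positive random variables, which is
  the meaning of the first four conjuncts.
\<close>

definition star_le ::
  "'a measure \<Rightarrow> ('a \<Rightarrow> real) \<Rightarrow> 'b measure \<Rightarrow> ('b \<Rightarrow> real) \<Rightarrow> bool" where
  "star_le M U N V \<longleftrightarrow>
     U \<in> borel_measurable M \<and> V \<in> borel_measurable N \<and>
     (AE \<omega> in M. 0 < U \<omega>) \<and> (AE \<omega> in N. 0 < V \<omega>) \<and>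
     mono_on {0<..} (\<lambda>x. rc_inverse (dist_fun N V) (dist_fun M U x) / ereal x)"

end

theory Submission
  imports Defs
begin

text \<open>
  Let \<open>T\<^sub>I\<^sub>,\<^sub>k(x)\<close> be the survival function of the \<open>k\<close>th order statistic of independent
  exponential variables with rates \<open>r\<^sub>i\<close>, \<open>i \<in> I\<close>, and \<open>B\<^sub>n\<^sub>,\<^sub>k\<close> its
  homogeneous version with \<open>n\<close> variables of rate 1. The star order says that
  \<open>T\<^sub>I\<^sub>,\<^sub>k(x) \<ge> B\<^sub>n\<^sub>,\<^sub>k(c x)\<close> with \<open>n = card I\<close> is, for every \<open>c > 0\<close>, a
  property of \<open>x\<close> that persists once it holds (\<open>exp_tail_crossing\<close>). Comparing the
  generalized inverses is then a matter of rewriting (\<open>rc_inverse_ratio_mono\<close>).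

  The crossing property is proved by induction on \<open>k\<close>. Let \<open>\<Lambda>\<close> be the sum of the rates.
  By lack of memory, the \<open>(k+1)\<close>st order statistic is the minimum, exponential with rate
  \<open>\<Lambda>\<close>, plus an independent variable with survival function
  \<open>V = \<Sum>i\<in>I. (r\<^sub>i / \<Lambda>) T\<^bsub>I - {i},k\<^esub>\<close>. In analytic form this is the
  differential equation \<open>T\<^sub>I\<^sub>,\<^sub>k\<^sub>+\<^sub>1' = \<Lambda> (V - T\<^sub>I\<^sub>,\<^sub>k\<^sub>+\<^sub>1)\<close>
  (\<open>exp_tail_derivative\<close>).

  If \<open>\<Lambda> \<le> n c\<close>, then \<open>T\<^sub>I\<^sub>,\<^sub>k\<^sub>+\<^sub>1(x) \<ge> B\<^sub>n\<^sub>,\<^sub>k\<^sub>+\<^sub>1(c x)\<close> for all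
  \<open>x \<ge> 0\<close>, because averaging the rates makes the order statistic stochastically smaller
  (\<open>hom_tail_mean_le_exp_tail\<close>), and there is nothing to cross.

  If \<open>n c < \<Lambda>\<close>, an exponential variable of rate \<open>n c\<close> is an exponential variable of
  rate \<open>\<Lambda>\<close> plus an independent delay that is 0 with probability
  \<open>\<theta> = n c / \<Lambda>\<close> and exponential with rate \<open>n c\<close> otherwise. So the homogeneous order
  statistic is also an exponential variable of rate \<open>\<Lambda>\<close> plus an independent variable,
  whose survival function \<open>W\<close> mixes \<open>B\<^sub>n\<^sub>-\<^sub>1\<^sub>,\<^sub>k(c x)\<close> and
  \<open>B\<^sub>n\<^sub>,\<^sub>k\<^sub>+\<^sub>1(c x)\<close> with weights \<open>\<theta>\<close> and \<open>1 - \<theta>\<close>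
  (\<open>delayed_tail\<close>). The difference \<open>D(x) = T\<^sub>I\<^sub>,\<^sub>k\<^sub>+\<^sub>1(x) - B\<^sub>n\<^sub>,\<^sub>k\<^sub>+\<^sub>1(c x)\<close>
  satisfies \<open>D(0) = 0\<close> and \<open>(e\<^bsup>\<Lambda>x\<^esup> D)' = \<Lambda> e\<^bsup>\<Lambda>x\<^esup> (V - W)\<close>. If the sign of
  \<open>V - W\<close> can only change from negative to nonnegative, the same follows for \<open>D\<close>.

  That \<open>V \<ge> W\<close> persists is \<open>mixture_crossing\<close>. It combines the induction hypothesis for
  each component of \<open>V\<close> with a tangent inequality for the map that sends \<open>B(t)\<close> to
  \<open>B(s t)\<close>, where \<open>s > 1\<close> and \<open>B = B\<^sub>n\<^sub>-\<^sub>1\<^sub>,\<^sub>k\<close>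
  (\<open>hom_tail_scale_tangent\<close>). This map is convex because \<open>f(s t) / f(t)\<close> decreases in
  \<open>t\<close> for the density \<open>f\<close> that belongs to \<open>B\<close>. The tangent inequality handles the
  mixture \<open>V\<close>, and the concavity of \<open>1 - e\<^bsup>-x\<^esup>\<close> handles the mixture \<open>W\<close>.
\<close>

section \<open>The number of successes in independent trials\<close>

text \<open>
  If independent events have probabilities \<open>p i\<close>, this is the probability that fewer than
  \<open>k\<close> of them occur; \<open>J\<close> is the set of those that do.
\<close>

definition fewer_than :: "('i \<Rightarrow> real) \<Rightarrow> 'i set \<Rightarrow> nat \<Rightarrow> real" where
  "fewer_than p I k = (\<Sum>J | J \<subseteq> I \<and> card J < k. (\<Prod>i\<in>J. p i) * (\<Prod>i\<in>I - J. 1 - p i))"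

lemma fewer_than_0 [simp]: "fewer_than p I 0 = 0"
  by (simp add: fewer_than_def)

lemma fewer_than_empty [simp]: "fewer_than p {} (Suc k) = 1"
proof -
  have "{J. J \<subseteq> {} \<and> card J < Suc k} = {{}::'a set}"
    by auto
  then show ?thesis
    by (simp add: fewer_than_def)
qed

lemma fewer_than_cong:
  assumes "I = I'" and "\<And>i. i \<in> I' \<Longrightarrow> p i = p' i"
  shows "fewer_than p I k = fewer_than p' I' k"
  unfolding fewer_than_def assms(1)
  using assms(2) by (intro sum.cong refl arg_cong2[where f = "(*)"] prod.cong) auto

text \<open>
  Conditioning on one trial: its success uses up one of the allowed successes.
\<close>

lemma fewer_than_insert:
  assumes "finite I" "i \<notin> I"
  shows "fewer_than p (insert i I) (Suc k) =
    (1 - p i) * fewer_than p I (Suc k) + p i * fewer_than p I k"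
proof -
  let ?t = "\<lambda>J. (\<Prod>j\<in>J. p j) * (\<Prod>j\<in>insert i I - J. 1 - p j)"
  let ?A = "{J. J \<subseteq> I \<and> card J < Suc k}" and ?B = "{J. J \<subseteq> I \<and> card J < k}"
  have fin: "finite ?A" "finite ?B"
    using assms(1) by simp_all
  have card_ins: "card (insert i J) = Suc (card J)" if "J \<subseteq> I" for J
    using that assms by (meson card_insert_disjoint finite_subset subsetD)
  have split: "{J. J \<subseteq> insert i I \<and> card J < Suc k} = ?A \<union> insert i ` ?B"
  proof (intro equalityI subsetI)
    fix J assume J: "J \<in> {J. J \<subseteq> insert i I \<and> card J < Suc k}"
    show "J \<in> ?A \<union> insert i ` ?B"
    proof (cases "i \<in> J")
      case True
      then have "J = insert i (J - {i})" "J - {i} \<subseteq> I"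
        using J by auto
      moreover have "card (J - {i}) < k"
        using J card_ins[of "J - {i}"] calculation by auto
      ultimately show ?thesis by blast
    qed (use J in auto)
  qed (auto simp: card_ins)
  have inj: "inj_on (insert i) ?B"
    by (rule inj_on_inverseI[where g = "\<lambda>J. J - {i}"]) (use assms(2) in auto)
  have "?A \<inter> insert i ` ?B = {}"
    using assms(2) by auto
  then have "fewer_than p (insert i I) (Suc k) = sum ?t ?A + (\<Sum>J\<in>?B. ?t (insert i J))"
    unfolding fewer_than_def split
    by (subst sum.union_disjoint) (use fin inj in \<open>auto simp: sum.reindex\<close>)
  also have "sum ?t ?A = (1 - p i) * fewer_than p I (Suc k)"
  proof -
    have "?t J = (1 - p i) * ((\<Prod>j\<in>J. p j) * (\<Prod>j\<in>I - J. 1 - p j))" if "J \<in> ?A" for J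
    proof -
      have "insert i I - J = insert i (I - J)"
        using that assms(2) by auto
      then show ?thesis using assms by simp
    qed
    then show ?thesis
      unfolding fewer_than_def sum_distrib_left by (intro sum.cong refl) auto
  qed
  also have "(\<Sum>J\<in>?B. ?t (insert i J)) = p i * fewer_than p I k"
  proof -
    have "?t (insert i J) = p i * ((\<Prod>j\<in>J. p j) * (\<Prod>j\<in>I - J. 1 - p j))" if "J \<in> ?B" for J
    proof -
      have "insert i I - insert i J = I - J" "i \<notin> J" "finite J"
        using that assms by (auto intro: finite_subset)
      then show ?thesis by simp
    qed
    then show ?thesis
      unfolding fewer_than_def sum_distrib_left by (intro sum.cong refl) auto
  qed
  finally show ?thesis .
qed

lemma fewer_than_mono:
  assumes "finite I" "\<And>i. i \<in> I \<Longrightarrow> 0 \<le> p i" "\<And>i. i \<in> I \<Longrightarrow> p i \<le> 1" "k \<le> k'"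
  shows "fewer_than p I k \<le> fewer_than p I k'"
  unfolding fewer_than_def
  using assms by (intro sum_mono2) (auto intro!: mult_nonneg_nonneg prod_nonneg)

lemma fewer_than_pos:
  assumes "finite I" "\<And>i. i \<in> I \<Longrightarrow> 0 \<le> p i" "\<And>i. i \<in> I \<Longrightarrow> p i < 1" "0 < k"
  shows "0 < fewer_than p I k"
proof -
  let ?t = "\<lambda>J. (\<Prod>i\<in>J. p i) * (\<Prod>i\<in>I - J. 1 - p i)"
  have "0 < ?t {}"
    using assms by (auto intro!: prod_pos)
  also have "?t {} \<le> fewer_than p I k"
    unfolding fewer_than_def
  proof (rule member_le_sum[of _ _ ?t])
    show "0 \<le> ?t J" if "J \<in> {J. J \<subseteq> I \<and> card J < k} - {{}}" for J
      using that assms(2) assms(3)[THEN less_imp_le] by (auto intro!: mult_nonneg_nonneg prod_nonneg)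
  qed (use assms in auto)
  finally show ?thesis .
qed

text \<open>
  The probabilities of all outcomes \<open>J\<close> add up to 1, by expanding
  \<open>\<Prod>i\<in>I. p i + (1 - p i)\<close>.
\<close>

lemma fewer_than_compl:
  assumes "finite I"
  shows "1 - fewer_than p I k =
    (\<Sum>J | J \<subseteq> I \<and> k \<le> card J. (\<Prod>i\<in>J. p i) * (\<Prod>i\<in>I - J. 1 - p i))"
proof -
  let ?t = "\<lambda>J. (\<Prod>i\<in>J. p i) * (\<Prod>i\<in>I - J. 1 - p i)"
  have "1 = (\<Prod>i\<in>I. p i + (1 - p i))"
    by simp
  also have "\<dots> = sum ?t (Pow I)"
    using assms by (rule prod_add)
  also have "Pow I = {J. J \<subseteq> I \<and> card J < k} \<union> {J. J \<subseteq> I \<and> k \<le> card J}"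
    by auto
  also have "sum ?t \<dots> = fewer_than p I k + sum ?t {J. J \<subseteq> I \<and> k \<le> card J}"
    unfolding fewer_than_def using assms by (intro sum.union_disjoint) auto
  finally show ?thesis by simp
qed

lemma fewer_than_less_1:
  assumes "finite I" "\<And>i. i \<in> I \<Longrightarrow> 0 < p i" "\<And>i. i \<in> I \<Longrightarrow> p i \<le> 1" "k \<le> card I"
  shows "fewer_than p I k < 1"
proof -
  let ?t = "\<lambda>J. (\<Prod>i\<in>J. p i) * (\<Prod>i\<in>I - J. 1 - p i)"
  have "0 < ?t I"
    using assms by (auto intro!: prod_pos)
  also have "?t I \<le> (\<Sum>J | J \<subseteq> I \<and> k \<le> card J. ?t J)"
  proof (rule member_le_sum[of _ _ ?t])
    show "0 \<le> ?t J" if "J \<in> {J. J \<subseteq> I \<and> k \<le> card J} - {I}" for J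
      using that assms(2)[THEN less_imp_le] assms(3) by (auto intro!: mult_nonneg_nonneg prod_nonneg)
  qed (use assms in auto)
  finally show ?thesis
    using fewer_than_compl[OF assms(1), of p k] by simp
qed

lemma fewer_than_const:
  assumes "finite I"
  shows "fewer_than (\<lambda>_. p) I k = (\<Sum>j<k. real (card I choose j) * p ^ j * (1 - p) ^ (card I - j))"
proof -
  have "fewer_than (\<lambda>_. p) I k =
      (\<Sum>J | J \<subseteq> I \<and> card J < k. p ^ card J * (1 - p) ^ (card I - card J))"
    unfolding fewer_than_def
    by (intro sum.cong refl) (use assms in \<open>auto simp: card_Diff_subset finite_subset\<close>)
  also have "\<dots> = (\<Sum>j<k. \<Sum>J | J \<in> {J. J \<subseteq> I \<and> card J < k} \<and> card J = j.
      p ^ card J * (1 - p) ^ (card I - card J))"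
    using assms by (intro sum.group[symmetric]) auto
  also have "\<dots> = (\<Sum>j<k. real (card I choose j) * p ^ j * (1 - p) ^ (card I - j))"
  proof (intro sum.cong refl)
    fix j assume "j \<in> {..<k}"
    then have "{J. J \<in> {J. J \<subseteq> I \<and> card J < k} \<and> card J = j} = {J. J \<subseteq> I \<and> card J = j}"
      by auto
    then show "(\<Sum>J | J \<in> {J. J \<subseteq> I \<and> card J < k} \<and> card J = j.
        p ^ card J * (1 - p) ^ (card I - card J)) = real (card I choose j) * p ^ j * (1 - p) ^ (card I - j)"
      using n_subsets[OF assms, of j] by simp
  qed
  finally show ?thesis .
qed

section \<open>Survival functions of exponential order statistics\<close>

text \<open>
  The \<open>k\<close>th smallest lifetime exceeds \<open>x\<close> iff fewer than \<open>k\<close> units have failed by time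
  \<open>x\<close>, which gives the survival function of the \<open>k\<close>th order statistic. For \<open>k = 0\<close> it is
  the constant 0, the right convention for the recursion in \<open>k\<close>.
\<close>

definition exp_tail :: "('i \<Rightarrow> real) \<Rightarrow> 'i set \<Rightarrow> nat \<Rightarrow> real \<Rightarrow> real" where
  "exp_tail r I k x = fewer_than (\<lambda>i. 1 - exp (- r i * x)) I k"

lemma exp_tail_0 [simp]: "exp_tail r I 0 x = 0"
  by (simp add: exp_tail_def)

lemma exp_tail_insert:
  assumes "finite I" "i \<notin> I"
  shows "exp_tail r (insert i I) (Suc k) x =
    exp (- r i * x) * exp_tail r I (Suc k) x + (1 - exp (- r i * x)) * exp_tail r I k x"
  using fewer_than_insert[OF assms] by (simp add: exp_tail_def)

lemma exp_tail_at_0 [simp]: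
  assumes "finite I"
  shows "exp_tail r I (Suc k) 0 = 1"
  using assms by (induction I) (simp_all add: exp_tail_insert, simp add: exp_tail_def)

lemma exp_tail_between:
  assumes "finite I" "\<And>i. i \<in> I \<Longrightarrow> 0 < r i" "0 < x" "0 < k" "k \<le> card I"
  shows "0 < exp_tail r I k x" "exp_tail r I k x < 1"
  unfolding exp_tail_def using assms
  by (auto intro!: fewer_than_pos fewer_than_less_1 simp: less_imp_le)

text \<open>
  Lack of memory at the first failure: after waiting with total rate \<open>sum r I\<close>, unit \<open>i\<close>
  fails first with probability proportional to \<open>r i\<close>, and the remaining units start afresh
  with one failure less to wait for. The proof conditions on one unit at a time instead:
  both sides of the equation follow the recursion \<open>exp_tail_insert\<close>.
\<close>

lemma exp_tail_derivative:
  assumes "finite I"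
  shows "(exp_tail r I (Suc k) has_real_derivative
    (\<Sum>i\<in>I. r i * (exp_tail r (I - {i}) k x - exp_tail r I (Suc k) x))) (at x)"
  using assms
proof (induction I arbitrary: k)
  case empty
  then show ?case by (simp add: exp_tail_def[abs_def])
next
  case (insert i I)
  let ?q = "exp (- r i * x)"
  let ?T = "\<lambda>I k. exp_tail r I k x"
  define d where "d = (\<lambda>k. \<Sum>j\<in>I. r j * (?T (I - {j}) k - ?T I (Suc k)))"
  \<comment> \<open>The derivative of the tail with index \<open>k\<close>, which the induction hypothesis provides only
    for a successor; index 0 is the constant 0.\<close>
  define e where "e = (case k of 0 \<Rightarrow> 0 | Suc k' \<Rightarrow> d k')"
  have T_k: "(exp_tail r I k has_real_derivative e) (at x)"
    using insert.IH by (cases k) (simp_all add: e_def d_def exp_tail_def[abs_def])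
  have e_eq: "e = (\<Sum>j\<in>I. r j * ((if k = 0 then 0 else ?T (I - {j}) (k - 1)) - ?T I k))"
    by (cases k) (simp_all add: e_def d_def)
  have rem: "?T (insert i I - {j}) k =
      ?q * ?T (I - {j}) k + (1 - ?q) * (if k = 0 then 0 else ?T (I - {j}) (k - 1))" if "j \<in> I" for j
  proof -
    have "insert i I - {j} = insert i (I - {j})"
      using that insert.hyps by auto
    then show ?thesis
      using insert.hyps by (cases k) (simp_all add: exp_tail_insert)
  qed
  have "((\<lambda>x. exp (- r i * x) * exp_tail r I (Suc k) x + (1 - exp (- r i * x)) * exp_tail r I k x)
      has_real_derivative
      (r i * ?q * (?T I k - ?T I (Suc k)) + ?q * d k + (1 - ?q) * e)) (at x)"
    by (rule derivative_eq_intros insert.IH T_k refl)+ (simp add: d_def algebra_simps)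
  moreover have "?q * d k + (1 - ?q) * e =
      (\<Sum>j\<in>I. r j * (?T (insert i I - {j}) k - ?T (insert i I) (Suc k)))"
    unfolding d_def e_eq sum_distrib_left sum.distrib[symmetric]
    by (intro sum.cong refl)
      (use insert.hyps in \<open>simp add: rem exp_tail_insert algebra_simps\<close>)
  moreover have "r i * ?q * (?T I k - ?T I (Suc k)) =
      r i * (?T (insert i I - {i}) k - ?T (insert i I) (Suc k))"
    using insert.hyps by (simp add: exp_tail_insert algebra_simps)
  moreover have "exp_tail r (insert i I) (Suc k) =
      (\<lambda>x. exp (- r i * x) * exp_tail r I (Suc k) x + (1 - exp (- r i * x)) * exp_tail r I k x)"
    using exp_tail_insert[OF insert.hyps] by blast
  ultimately have "(exp_tail r (insert i I) (Suc k) has_real_derivative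
      r i * (?T (insert i I - {i}) k - ?T (insert i I) (Suc k)) +
      (\<Sum>j\<in>I. r j * (?T (insert i I - {j}) k - ?T (insert i I) (Suc k)))) (at x)"
    by (simp only: add.assoc)
  then show ?case
    using insert.hyps by simp
qed

section \<open>The homogeneous sample\<close>

text \<open>
  The survival function at unit rate, as a binomial distribution function. It depends on the
  index set only through its size, so that samples with different units removed can be compared
  with the same function; another rate \<open>c\<close> only rescales time.
\<close>

definition hom_tail :: "nat \<Rightarrow> nat \<Rightarrow> real \<Rightarrow> real" where
  "hom_tail n k x = (\<Sum>j<k. real (n choose j) * (1 - exp (- x)) ^ j * exp (- x) ^ (n - j))"

lemma exp_tail_const:
  assumes "finite I"
  shows "exp_tail (\<lambda>_. c) I k x = hom_tail (card I) k (c * x)"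
  using fewer_than_const[OF assms, of "1 - exp (- c * x)" k]
  by (simp add: exp_tail_def hom_tail_def)

lemma hom_tail_eq_exp_tail: "hom_tail n k x = exp_tail (\<lambda>_. 1) {..<n} k x"
  by (simp add: exp_tail_const)

lemma hom_tail_0 [simp]: "hom_tail n 0 x = 0"
  by (simp add: hom_tail_def)

lemma hom_tail_between:
  assumes "0 < x" "0 < k" "k \<le> n"
  shows "0 < hom_tail n k x" "hom_tail n k x < 1"
  using exp_tail_between[of "{..<n}" "\<lambda>_. 1" x k] assms
  by (simp_all add: hom_tail_eq_exp_tail)

text \<open>
  Adding one unit and one required failure can turn death into survival only if exactly \<open>k\<close>
  of the old units have failed and the new one has not.
\<close>

lemma hom_tail_Suc_Suc:
  "hom_tail (Suc n) (Suc k) x - hom_tail n k x =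
    real (n choose k) * (1 - exp (- x)) ^ k * exp (- x) ^ Suc (n - k)"
proof -
  have "hom_tail (Suc n) (Suc k) x =
      exp (- x) * hom_tail n (Suc k) x + (1 - exp (- x)) * hom_tail n k x"
    using exp_tail_insert[of "{..<n}" n "\<lambda>_. 1" k x]
    by (simp add: hom_tail_eq_exp_tail lessThan_Suc)
  moreover have "hom_tail n (Suc k) x =
      hom_tail n k x + real (n choose k) * (1 - exp (- x)) ^ k * exp (- x) ^ (n - k)"
    by (simp add: hom_tail_def)
  ultimately show ?thesis
    by (simp add: algebra_simps)
qed

lemma hom_tail_derivative_diff:
  "(hom_tail (Suc n) (Suc k) has_real_derivative
     Suc n * (hom_tail n k x - hom_tail (Suc n) (Suc k) x)) (at x)"
proof -
  have "exp_tail (\<lambda>_. 1) ({..<Suc n} - {i}) k x = hom_tail n k x" if "i < Suc n" for i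
    using exp_tail_const[of "{..<Suc n} - {i}" 1 k x] that by simp
  moreover have "exp_tail (\<lambda>_. 1) {..<Suc n} (Suc k) = hom_tail (Suc n) (Suc k)"
    by (simp add: fun_eq_iff exp_tail_const)
  ultimately show ?thesis
    using exp_tail_derivative[of "{..<Suc n}" "\<lambda>_. 1" k x] by simp
qed

text \<open>
  The density of the order statistic of rank \<open>Suc k\<close> among \<open>Suc n\<close> units of rate 1. The
  successors keep truncated subtraction out of the exponents.
\<close>

definition hom_density :: "nat \<Rightarrow> nat \<Rightarrow> real \<Rightarrow> real" where
  "hom_density n k x =
    real (Suc n) * real (n choose k) * (1 - exp (- x)) ^ k * exp (- x) ^ Suc (n - k)"

lemma hom_tail_derivative:
  "(hom_tail (Suc n) (Suc k) has_real_derivative - hom_density n k x) (at x)"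
  by (rule hom_tail_derivative_diff[THEN DERIV_cong])
    (use hom_tail_Suc_Suc[of n k x] in \<open>simp add: hom_density_def algebra_simps\<close>)

lemma hom_density_pos:
  assumes "0 < x" "k \<le> n"
  shows "0 < hom_density n k x"
  using assms by (simp add: hom_density_def)

lemma hom_tail_antimono:
  assumes "0 \<le> x" "x \<le> y"
  shows "hom_tail (Suc n) (Suc k) y \<le> hom_tail (Suc n) (Suc k) x"
proof (rule DERIV_nonpos_imp_nonincreasing[OF assms(2)])
  fix t assume "x \<le> t" "t \<le> y"
  then have "0 \<le> hom_density n k t"
    using assms by (auto simp: hom_density_def)
  then show "\<exists>d. (hom_tail (Suc n) (Suc k) has_real_derivative d) (at t) \<and> d \<le> 0"
    using hom_tail_derivative[of n k t] by (intro exI[of _ "- hom_density n k t"]) simp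
qed

text \<open>
  As a function of the failure probability of a unit, the tail is a polynomial that runs from 1
  at 0 to 0 at 1, so the intermediate value theorem applies on a compact interval.
\<close>

lemma hom_tail_surj:
  assumes "0 < v" "v < 1" "k \<le> n"
  obtains t where "0 < t" "hom_tail (Suc n) (Suc k) t = v"
proof -
  define b where "b = (\<lambda>p::real. fewer_than (\<lambda>_. p) {..<Suc n} (Suc k))"
  have b: "b p = (\<Sum>j<Suc k. real (Suc n choose j) * p ^ j * (1 - p) ^ (Suc n - j))" for p
    unfolding b_def by (subst fewer_than_const) auto
  have "b 1 = 0"
    unfolding b using assms(3) by (intro sum.neutral) (auto simp: power_0_left)
  moreover have "b 0 = 1"
    unfolding b by (subst sum.remove[of _ 0]) (auto intro!: sum.neutral simp: power_0_left)
  moreover have "continuous_on {0..1} b"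
    unfolding b[abs_def] by (intro continuous_intros)
  ultimately obtain p where p: "0 \<le> p" "p \<le> 1" "b p = v"
    using IVT2'[of b 1 v 0] assms by auto
  have "p \<noteq> 0" "p \<noteq> 1"
    using p \<open>b 0 = 1\<close> \<open>b 1 = 0\<close> assms by auto
  then have "0 < p" "p < 1"
    using p by auto
  show thesis
  proof
    show "0 < - ln (1 - p)"
      using \<open>0 < p\<close> \<open>p < 1\<close> by simp
    show "hom_tail (Suc n) (Suc k) (- ln (1 - p)) = v"
      using p(3) \<open>p < 1\<close> by (simp add: hom_tail_def b)
  qed
qed

section \<open>Convexity under a change of time scale\<close>

text \<open>
  The chord of the convex function \<open>exp\<close> from \<open>0\<close> to \<open>s * x\<close> lies above the graph at \<open>x\<close>.
  For negative \<open>x\<close> this is the concavity estimate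
  \<open>1 - exp (- (s * t)) \<le> s * (1 - exp (- t))\<close>.
\<close>

lemma exp_scale_ge:
  fixes s x :: real
  assumes "1 \<le> s"
  shows "s * (exp x - 1) \<le> exp (s * x) - 1"
proof -
  have "1 - x \<le> exp (- x)"
    using exp_ge_add_one_self[of "- x"] by simp
  then have "(1 - x) * exp x \<le> 1"
    by (simp add: exp_minus field_simps)
  then have "0 \<le> (s - 1) * (x * exp x - exp x + 1)"
    using assms by (intro mult_nonneg_nonneg) (simp_all add: algebra_simps)
  moreover have "exp x * (1 + (s - 1) * x) \<le> exp x * exp ((s - 1) * x)"
    using exp_ge_add_one_self[of "(s - 1) * x"] by (intro mult_left_mono) simp_all
  moreover have "exp x * exp ((s - 1) * x) = exp (s * x)"
    by (simp add: exp_add[symmetric] algebra_simps)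
  ultimately show ?thesis
    by (simp add: algebra_simps)
qed

text \<open>
  The quotient \<open>(1 - exp (- (s * v))) / (1 - exp (- v))\<close> decreases in \<open>v\<close>: the sign of its
  derivative is that of \<open>s * (exp v - 1) - (exp (s * v) - 1)\<close>.
\<close>

lemma exp_cdf_scale_ratio:
  fixes s t u :: real
  assumes "1 \<le> s" "0 < t" "t \<le> u"
  shows "(1 - exp (- (s * u))) * (1 - exp (- t)) \<le> (1 - exp (- (s * t))) * (1 - exp (- u))"
proof -
  let ?R = "\<lambda>v. (1 - exp (- (s * v))) / (1 - exp (- v))"
  have "?R u \<le> ?R t"
  proof (rule DERIV_nonpos_imp_nonincreasing[OF assms(3)])
    fix v assume "t \<le> v" "v \<le> u"
    then have v: "0 < v" using assms by simp
    let ?d = "(s * exp (- (s * v)) * (1 - exp (- v)) - (1 - exp (- (s * v))) * exp (- v)) /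
      ((1 - exp (- v)) * (1 - exp (- v)))"
    have "(?R has_real_derivative ?d) (at v)"
      using v by (auto intro!: derivative_eq_intros simp: algebra_simps)
    moreover have "exp (- (s * v)) * exp (- v) * (s * (exp v - 1)) \<le>
        exp (- (s * v)) * exp (- v) * (exp (s * v) - 1)"
      using exp_scale_ge[OF assms(1), of v] by (intro mult_left_mono) simp_all
    then have "s * exp (- (s * v)) * (1 - exp (- v)) \<le> (1 - exp (- (s * v))) * exp (- v)"
      by (simp add: exp_minus field_simps)
    then have "?d \<le> 0"
      using v by (intro divide_nonpos_pos) simp_all
    ultimately show "\<exists>d. (?R has_real_derivative d) (at v) \<and> d \<le> 0"
      by blast
  qed
  then show ?thesis
    using assms by (simp add: field_simps)
qed

text \<open>
  In other words \<open>hom_density n k (s * t) / hom_density n k t\<close> decreases in \<open>t\<close>, which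
  expresses that the logarithm of the order statistic has a log-concave density. Each factor of
  the density has this property.
\<close>

lemma hom_density_scale_ratio:
  assumes "1 \<le> s" "0 < t" "t \<le> u"
  shows "hom_density n k (s * u) * hom_density n k t \<le> hom_density n k (s * t) * hom_density n k u"
proof -
  have "0 \<le> (s - 1) * (u - t)"
    using assms by simp
  then have q: "exp (- (s * u)) * exp (- t) \<le> exp (- (s * t)) * exp (- u)"
    unfolding exp_add[symmetric] by (simp add: algebra_simps)
  have su: "0 \<le> s * u"
    using assms by simp
  have "((1 - exp (- (s * u))) * (1 - exp (- t))) ^ k * (exp (- (s * u)) * exp (- t)) ^ Suc (n - k)
      \<le> ((1 - exp (- (s * t))) * (1 - exp (- u))) ^ k * (exp (- (s * t)) * exp (- u)) ^ Suc (n - k)"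
    using assms su
    by (intro mult_mono power_mono exp_cdf_scale_ratio q zero_le_power mult_nonneg_nonneg) simp_all
  then have "(real (Suc n) * real (n choose k))\<^sup>2 *
      (((1 - exp (- (s * u))) * (1 - exp (- t))) ^ k * (exp (- (s * u)) * exp (- t)) ^ Suc (n - k))
      \<le> (real (Suc n) * real (n choose k))\<^sup>2 *
      (((1 - exp (- (s * t))) * (1 - exp (- u))) ^ k * (exp (- (s * t)) * exp (- u)) ^ Suc (n - k))"
    by (rule mult_left_mono) simp
  then show ?thesis
    unfolding hom_density_def power_mult_distrib power2_eq_square by (simp only: mult_ac)
qed

text \<open>
  The map from \<open>hom_tail t\<close> to \<open>hom_tail (s * t)\<close> has slope
  \<open>s * hom_density (s * t) / hom_density t\<close>, which decreases in \<open>t\<close> and so increases with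
  \<open>hom_tail t\<close>: the map is convex and lies above its tangent at \<open>a\<close>.
\<close>

lemma hom_tail_scale_tangent:
  assumes "1 < s" "0 < a" "0 < t" "k \<le> n"
  shows "s * (hom_density n k (s * a) / hom_density n k a) *
      (hom_tail (Suc n) (Suc k) t - hom_tail (Suc n) (Suc k) a)
    \<le> hom_tail (Suc n) (Suc k) (s * t) - hom_tail (Suc n) (Suc k) (s * a)"
proof -
  let ?f = "hom_density n k" and ?B = "hom_tail (Suc n) (Suc k)"
  let ?g = "\<lambda>u. ?B (s * u) - s * (?f (s * a) / ?f a) * ?B u"
  let ?d = "\<lambda>u. s * (?f (s * a) / ?f a * ?f u - ?f (s * u))"
  have fa: "0 < ?f a"
    using assms by (intro hom_density_pos)
  have g: "(?g has_real_derivative ?d u) (at u)" for u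
    by (rule derivative_eq_intros refl hom_tail_derivative
        DERIV_chain2[where g = "(*) s", OF hom_tail_derivative])+ (simp add: algebra_simps)
  have "?g a \<le> ?g t"
  proof (cases "t \<le> a")
    case True
    show ?thesis
    proof (rule DERIV_nonpos_imp_nonincreasing[OF True])
      fix u assume "t \<le> u" "u \<le> a"
      then have "?f (s * a) * ?f u \<le> ?f (s * u) * ?f a"
        using assms by (intro hom_density_scale_ratio) auto
      then have "?d u \<le> 0"
        using fa assms by (intro mult_nonneg_nonpos) (simp_all add: field_simps)
      then show "\<exists>d. (?g has_real_derivative d) (at u) \<and> d \<le> 0"
        using g by blast
    qed
  next
    case False
    then have "a \<le> t" by simp
    then show ?thesis
    proof (rule DERIV_nonneg_imp_nondecreasing)
      fix u assume "a \<le> u" "u \<le> t"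
      then have "?f (s * u) * ?f a \<le> ?f (s * a) * ?f u"
        using assms by (intro hom_density_scale_ratio) auto
      then have "0 \<le> ?d u"
        using fa assms by (intro mult_nonneg_nonneg) (simp_all add: field_simps)
      then show "\<exists>d. (?g has_real_derivative d) (at u) \<and> 0 \<le> d"
        using g by blast
    qed
  qed
  then show ?thesis
    unfolding right_diff_distrib by linarith
qed

section \<open>Crossing of mixtures\<close>

text \<open>
  With \<open>\<beta> = 0\<close> it is the homogeneous tail just after the first of \<open>Suc n\<close> units has failed,
  with \<open>\<beta> = 1\<close> the tail before that failure. In between it is the tail of what remains of the
  homogeneous order statistic after an initial wait that is shorter than the first failure time
  and has probability \<open>1 - \<beta>\<close> of ending with that failure.
\<close>

definition delayed_tail :: "real \<Rightarrow> nat \<Rightarrow> nat \<Rightarrow> real \<Rightarrow> real" where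
  "delayed_tail \<beta> n k x = hom_tail n k x + \<beta> * (hom_tail (Suc n) (Suc k) x - hom_tail n k x)"

text \<open>
  The correction is a multiple of the density times \<open>1 - exp (- x)\<close>. This form makes it
  comparable with the slope in \<open>hom_tail_scale_tangent\<close>.
\<close>

lemma delayed_tail_eq:
  assumes "k \<le> n"
  shows "delayed_tail \<beta> (Suc n) (Suc k) x = hom_tail (Suc n) (Suc k) x +
    \<beta> / real (Suc k) * ((1 - exp (- x)) * hom_density n k x)"
proof -
  have "real (Suc k) * real (Suc n choose Suc k) = real (Suc n) * real (n choose k)"
    unfolding of_nat_mult[symmetric] Suc_times_binomial ..
  then have "real (Suc n choose Suc k) = real (Suc n) * real (n choose k) / real (Suc k)"
    by (simp add: field_simps)
  then show ?thesis
    by (simp add: delayed_tail_def hom_tail_Suc_Suc hom_density_def)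
qed

text \<open>
  Here \<open>v i\<close> and \<open>v' i\<close> are the values at \<open>x\<close> and \<open>y\<close> of survival functions that cross every
  rescaled homogeneous tail at most once, from below. Write \<open>s = y / x\<close> and \<open>a = c * x\<close>.
  Choosing \<open>t\<close> with \<open>B t = v i\<close> gives \<open>B (s * t) \<le> v' i\<close>, and the tangent inequality at
  \<open>a\<close> bounds \<open>B (s * t)\<close> below by an affine function of \<open>v i\<close>. Averaging these affine bounds
  needs only the average of the \<open>v i\<close>. What remains is that the tangent, evaluated at the
  delayed tail, dominates the delayed tail at \<open>y\<close>, which reduces to
  \<open>1 - exp (- (s * a)) \<le> s * (1 - exp (- a))\<close>.
\<close>

lemma mixture_crossing:
  assumes "finite I" and w: "\<And>i. i \<in> I \<Longrightarrow> 0 \<le> w i" "sum w I = 1"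
    and "k \<le> n" "0 \<le> \<beta>" "0 < c" "0 < x" "x < y"
    and v: "\<And>i. i \<in> I \<Longrightarrow> 0 < v i" "\<And>i. i \<in> I \<Longrightarrow> v i < 1"
    and cross: "\<And>i c. i \<in> I \<Longrightarrow> 0 < c \<Longrightarrow> hom_tail (Suc n) (Suc k) (c * x) \<le> v i \<Longrightarrow>
      hom_tail (Suc n) (Suc k) (c * y) \<le> v' i"
    and le: "delayed_tail \<beta> (Suc n) (Suc k) (c * x) \<le> (\<Sum>i\<in>I. w i * v i)"
  shows "delayed_tail \<beta> (Suc n) (Suc k) (c * y) \<le> (\<Sum>i\<in>I. w i * v' i)"
proof -
  let ?B = "hom_tail (Suc n) (Suc k)" and ?f = "hom_density n k"
  define s where "s = y / x"
  define a where "a = c * x"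
  define m where "m = s * (?f (s * a) / ?f a)"
  define \<kappa> where "\<kappa> = \<beta> / real (Suc k)"
  have s: "1 < s" and a: "0 < a" and sa: "s * a = c * y" and \<kappa>: "0 \<le> \<kappa>"
    using assms by (simp_all add: s_def a_def \<kappa>_def)
  have fa: "0 < ?f a" and fsa: "0 < ?f (s * a)"
    using a s assms by (auto intro!: hom_density_pos)
  have m: "0 < m"
    unfolding m_def using fa fsa s by simp
  have each: "m * (v i - ?B a) + ?B (s * a) \<le> v' i" if i: "i \<in> I" for i
  proof -
    obtain t where t: "0 < t" "?B t = v i"
      by (rule hom_tail_surj[OF v(1)[OF i] v(2)[OF i] assms(4)])
    \<comment> \<open>the hypothesis with the scale \<open>t / x\<close>, at which the tail meets the homogeneous one at \<open>x\<close>\<close>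
    have "?B (t / x * y) \<le> v' i"
      using i t assms by (intro cross) auto
    moreover have "m * (?B t - ?B a) \<le> ?B (s * t) - ?B (s * a)"
      unfolding m_def using s a t assms by (intro hom_tail_scale_tangent)
    ultimately show ?thesis
      using t by (simp add: s_def field_simps)
  qed
  have "m * \<kappa> * (1 - exp (- a)) * ?f a + ?B (s * a) =
      m * (delayed_tail \<beta> (Suc n) (Suc k) a - ?B a) + ?B (s * a)"
    using assms by (simp add: delayed_tail_eq \<kappa>_def)
  also have "\<dots> \<le> m * ((\<Sum>i\<in>I. w i * v i) - ?B a) + ?B (s * a)"
    using le m by (simp add: a_def)
  also have "\<dots> = m * ((\<Sum>i\<in>I. w i * v i) - sum w I * ?B a) + sum w I * ?B (s * a)"
    using w by simp
  also have "\<dots> = (\<Sum>i\<in>I. w i * (m * (v i - ?B a) + ?B (s * a)))"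
    by (simp add: algebra_simps sum.distrib sum_subtractf sum_distrib_left sum_distrib_right)
  also have "\<dots> \<le> (\<Sum>i\<in>I. w i * v' i)"
    using each w by (intro sum_mono mult_left_mono) auto
  finally have "m * \<kappa> * (1 - exp (- a)) * ?f a + ?B (s * a) \<le> (\<Sum>i\<in>I. w i * v' i)" .
  moreover have "\<kappa> * ((1 - exp (- (s * a))) * ?f (s * a)) \<le> \<kappa> * ((s * (1 - exp (- a))) * ?f (s * a))"
    using exp_scale_ge[of s "- a"] s \<kappa> fsa by (intro mult_left_mono mult_right_mono) (simp_all add: algebra_simps)
  moreover have "m * \<kappa> * (1 - exp (- a)) * ?f a = \<kappa> * ((s * (1 - exp (- a))) * ?f (s * a))"
    using fa by (simp add: m_def)
  ultimately have "?B (s * a) + \<kappa> * ((1 - exp (- (s * a))) * ?f (s * a)) \<le> (\<Sum>i\<in>I. w i * v' i)"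
    by linarith
  then show ?thesis
    using assms by (simp only: delayed_tail_eq sa[symmetric] \<kappa>_def)
qed

section \<open>Averaging the rates\<close>

text \<open>
  Two units enter only through the probabilities that both survive and that both fail. In the
  first an order statistic tail can only increase, in the second it can only decrease.
\<close>

lemma exp_tail_pair:
  assumes "finite R" "i \<notin> R" "j \<notin> R" "i \<noteq> j"
  shows "exp_tail r (insert i (insert j R)) (Suc (Suc k)) x =
    exp (- r i * x) * exp (- r j * x) * (exp_tail r R (Suc (Suc k)) x - exp_tail r R (Suc k) x) +
    exp_tail r R (Suc k) x -
    (1 - exp (- r i * x)) * (1 - exp (- r j * x)) * (exp_tail r R (Suc k) x - exp_tail r R k x)"
  using assms by (simp add: exp_tail_insert algebra_simps)

text \<open>
  Moving two rates towards each other with their sum fixed leaves the probability that both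
  units survive unchanged. The sum of the two survival probabilities decreases by convexity, so
  the probability that both units fail increases.
\<close>

lemma exp_tail_smoothing:
  assumes "finite I" "i \<in> I" "j \<in> I" "\<And>l. l \<in> I \<Longrightarrow> 0 \<le> r l" "0 \<le> x" "r i \<le> \<mu>" "\<mu> \<le> r j" "i \<noteq> j"
  shows "exp_tail (r(i := \<mu>, j := r i + r j - \<mu>)) I k x \<le> exp_tail r I k x"
proof -
  define r' where "r' = r(i := \<mu>, j := r i + r j - \<mu>)"
  define R where "R = I - {i, j}"
  have R: "finite R" "i \<notin> R" "j \<notin> R" "I = insert i (insert j R)"
    using assms by (auto simp: R_def)
  have r': "r' i = \<mu>" "r' j = r i + r j - \<mu>"
    using assms by (simp_all add: r'_def)
  have R_eq: "exp_tail r' R h x = exp_tail r R h x" for h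
    unfolding exp_tail_def by (intro fewer_than_cong) (use R in \<open>auto simp: r'_def\<close>)
  let ?qi = "exp (- r i * x)" and ?qj = "exp (- r j * x)"
    and ?a = "exp (- r' i * x)" and ?b = "exp (- r' j * x)"
  have ab: "?a * ?b = ?qi * ?qj"
    unfolding exp_add[symmetric] r' by (simp add: algebra_simps)
  \<comment> \<open>\<open>?a\<close> lies between \<open>?qi\<close> and \<open>?qj\<close> and the two pairs have the same product, so
    \<open>?a + ?b \<le> ?qi + ?qj\<close>.\<close>
  have "?qj \<le> ?a" "?a \<le> ?qi"
    using assms by (simp_all add: r' mult_right_mono)
  then have "0 \<le> (?qi - ?a) * (?a - ?qj)"
    by simp
  then have "?a * (?a + ?b) \<le> ?a * (?qi + ?qj)"
    using ab by (simp add: algebra_simps)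
  then have "?a + ?b \<le> ?qi + ?qj"
    by (simp only: mult_le_cancel_left_pos[OF exp_gt_zero])
  then have v: "(1 - ?qi) * (1 - ?qj) \<le> (1 - ?a) * (1 - ?b)"
    using ab by (simp add: algebra_simps)
  have mono: "exp_tail r R h x \<le> exp_tail r R (Suc h) x" for h
    unfolding exp_tail_def
    by (rule fewer_than_mono) (use assms R in auto)
  show ?thesis
  proof (cases k)
    case 0
    then show ?thesis by simp
  next
    case (Suc k')
    show ?thesis
    proof (cases k')
      case 0
      have "exp_tail r' I (Suc 0) x = ?a * ?b * exp_tail r R (Suc 0) x"
        "exp_tail r I (Suc 0) x = ?qi * ?qj * exp_tail r R (Suc 0) x"
        using R assms by (simp_all add: exp_tail_insert R_eq)
      then show ?thesis
        using ab Suc 0 by (simp add: r'_def)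
    next
      case (Suc h)
      have "(1 - ?qi) * (1 - ?qj) * (exp_tail r R (Suc h) x - exp_tail r R h x)
          \<le> (1 - ?a) * (1 - ?b) * (exp_tail r R (Suc h) x - exp_tail r R h x)"
        using v mono[of h] by (intro mult_right_mono) simp_all
      then have "exp_tail r' I (Suc (Suc h)) x \<le> exp_tail r I (Suc (Suc h)) x"
        unfolding R(4) exp_tail_pair[OF R(1-3) assms(8)] R_eq ab by linarith
      then show ?thesis
        using \<open>k = Suc k'\<close> Suc by (simp add: r'_def)
    qed
  qed
qed

text \<open>
  A homogeneous sample with the mean rate has stochastically the smallest order statistics.
  Smoothing a rate below the mean against one above it, so that one of them becomes the mean,
  reduces the number of rates that differ from the mean.
\<close>

lemma hom_tail_mean_le_exp_tail:
  assumes "finite I" "\<And>i. i \<in> I \<Longrightarrow> 0 \<le> r i" "0 \<le> x" "sum r I = real (card I) * \<mu>"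
  shows "hom_tail (card I) k (\<mu> * x) \<le> exp_tail r I k x"
  using assms(2,4)
proof (induction "card {i \<in> I. r i \<noteq> \<mu>}" arbitrary: r rule: less_induct)
  case less
  have sum0: "(\<Sum>i\<in>I. r i - \<mu>) = 0"
    using less.prems by (simp add: sum_subtractf)
  show ?case
  proof (cases "\<forall>i\<in>I. r i = \<mu>")
    case True
    then have "exp_tail r I k x = exp_tail (\<lambda>_. \<mu>) I k x"
      unfolding exp_tail_def by (intro fewer_than_cong) simp_all
    then show ?thesis
      using assms(1) by (simp add: exp_tail_const)
  next
    case False
    then obtain l where l: "l \<in> I" "r l \<noteq> \<mu>" by blast
    have "\<exists>i\<in>I. r i < \<mu>"
    proof (rule ccontr)
      assume "\<not> ?thesis"
      then have "\<forall>i\<in>I. r i - \<mu> = 0"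
        using sum_nonneg_eq_0_iff[of I "\<lambda>i. r i - \<mu>"] sum0 assms(1) by (simp add: not_less)
      then show False using l by auto
    qed
    then obtain i where i: "i \<in> I" "r i < \<mu>" by blast
    have "\<exists>j\<in>I. \<mu> < r j"
    proof (rule ccontr)
      assume "\<not> ?thesis"
      then have "\<forall>i\<in>I. r i - \<mu> = 0"
        using sum_nonneg_eq_0_iff[of I "\<lambda>i. \<mu> - r i"] sum0 assms(1)
        by (simp add: not_less sum_subtractf)
      then show False using l by auto
    qed
    then obtain j where j: "j \<in> I" "\<mu> < r j" by blast
    have ij: "i \<noteq> j" using i j by auto
    define r' where "r' = r(i := \<mu>, j := r i + r j - \<mu>)"
    have "{l \<in> I. r' l \<noteq> \<mu>} \<subset> {l \<in> I. r l \<noteq> \<mu>}"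
      using i j ij by (auto simp: r'_def)
    then have "card {l \<in> I. r' l \<noteq> \<mu>} < card {l \<in> I. r l \<noteq> \<mu>}"
      using assms(1) by (intro psubset_card_mono) simp_all
    moreover have "0 \<le> r' l" if "l \<in> I" for l
      using less.prems(1)[OF that] less.prems(1)[OF i(1)] i j by (auto simp: r'_def)
    moreover have "sum r' I = real (card I) * \<mu>"
    proof -
      have split: "sum g I = g i + (g j + sum g (I - {i} - {j}))" for g :: "'a \<Rightarrow> real"
        using i j ij assms(1) by (simp add: sum.remove[of I i] sum.remove[of "I - {i}" j])
      have "sum r' (I - {i} - {j}) = sum r (I - {i} - {j})"
        by (intro sum.cong) (auto simp: r'_def)
      then show ?thesis
        using ij unfolding less.prems(2)[symmetric] split[of r] split[of r'] by (simp add: r'_def)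
    qed
    ultimately have "hom_tail (card I) k (\<mu> * x) \<le> exp_tail r' I k x"
      by (rule less.hyps)
    also have "\<dots> \<le> exp_tail r I k x"
      unfolding r'_def using assms(1,3) less.prems(1) i j ij by (intro exp_tail_smoothing) auto
    finally show ?thesis .
  qed
qed

section \<open>Single crossing of the survival functions\<close>

text \<open>
  The induction on \<open>k\<close> removes the first failure. When \<open>c\<close> is at least the mean rate, the
  comparison holds everywhere. Otherwise the waiting time for the first failure is shared by both
  samples as an exponential variable of rate \<open>\<Lambda>\<close>, and \<open>V\<close> and \<open>W\<close> are the tails of what
  remains. Convolution with the common part preserves the single crossing, as
  \<open>E\<close> below starts at 0 and its derivative has the sign of \<open>V - W\<close>.
\<close>

theorem exp_tail_crossing:
  assumes "finite I" "\<And>i. i \<in> I \<Longrightarrow> 0 < r i" "0 < k" "k \<le> card I" "0 < c" "0 < x" "x < y"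
    and "hom_tail (card I) k (c * x) \<le> exp_tail r I k x"
  shows "hom_tail (card I) k (c * y) \<le> exp_tail r I k y"
  using assms
proof (induction k arbitrary: I c x y)
  case 0
  then show ?case by simp
next
  case (Suc k)
  obtain m where m: "card I = Suc m" "k \<le> m"
    using Suc.prems by (cases "card I") auto
  define \<Lambda> where "\<Lambda> = sum r I"
  have "I \<noteq> {}" using m by auto
  then have \<Lambda>: "0 < \<Lambda>"
    unfolding \<Lambda>_def using Suc.prems by (intro sum_pos) auto
  have card_rem: "card (I - {i}) = m" if "i \<in> I" for i
    using that m Suc.prems by simp
  show ?case
  proof (cases "\<Lambda> \<le> real (Suc m) * c")
    case True
    have "hom_tail (Suc m) (Suc k) (c * y) \<le> hom_tail (Suc m) (Suc k) (\<Lambda> / real (Suc m) * y)"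
      using True Suc.prems \<Lambda>
      by (intro hom_tail_antimono mult_right_mono) (simp_all add: field_simps)
    also have "\<dots> \<le> exp_tail r I (Suc k) y"
      using hom_tail_mean_le_exp_tail[of I r y "\<Lambda> / real (Suc m)" "Suc k"] Suc.prems m
      by (simp add: \<Lambda>_def less_imp_le)
    finally show ?thesis using m by simp
  next
    case False
    define \<theta> where "\<theta> = real (Suc m) * c / \<Lambda>"
    have \<theta>: "\<theta> < 1"
      using False \<Lambda> by (simp add: \<theta>_def)
    have \<Lambda>\<theta>: "\<Lambda> * \<theta> = real (Suc m) * c"
      using \<Lambda> by (simp add: \<theta>_def)
    define V where "V = (\<lambda>t. \<Sum>i\<in>I. r i / \<Lambda> * exp_tail r (I - {i}) k t)"
    define W where "W = (\<lambda>t. delayed_tail (1 - \<theta>) m k (c * t))"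
    define D where "D = (\<lambda>t. exp_tail r I (Suc k) t - hom_tail (Suc m) (Suc k) (c * t))"
    define E where "E = (\<lambda>t. exp (\<Lambda> * t) * D t)"
    have dD: "(D has_real_derivative \<Lambda> * (V t - W t) - \<Lambda> * D t) (at t)" for t
    proof -
      have "(\<Sum>i\<in>I. r i * (exp_tail r (I - {i}) k t - exp_tail r I (Suc k) t)) =
          \<Lambda> * V t - \<Lambda> * exp_tail r I (Suc k) t"
        using \<Lambda> by (simp add: V_def sum_distrib_left right_diff_distrib sum_subtractf
            sum_distrib_right[symmetric] \<Lambda>_def[symmetric])
      then have T: "(exp_tail r I (Suc k) has_real_derivative
          \<Lambda> * V t - \<Lambda> * exp_tail r I (Suc k) t) (at t)"
        using exp_tail_derivative[OF Suc.prems(1), of r k t] by simp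
      have "((\<lambda>t. hom_tail (Suc m) (Suc k) (c * t)) has_real_derivative
          real (Suc m) * (hom_tail m k (c * t) - hom_tail (Suc m) (Suc k) (c * t)) * c) (at t)"
        by (rule DERIV_chain2[OF hom_tail_derivative_diff]) (auto intro!: derivative_eq_intros)
      then have "(D has_real_derivative \<Lambda> * V t - \<Lambda> * exp_tail r I (Suc k) t -
          real (Suc m) * (hom_tail m k (c * t) - hom_tail (Suc m) (Suc k) (c * t)) * c) (at t)"
        unfolding D_def by (intro DERIV_diff T)
      moreover have "real (Suc m) * (hom_tail m k (c * t) - hom_tail (Suc m) (Suc k) (c * t)) * c =
          (\<Lambda> * \<theta>) * (hom_tail m k (c * t) - hom_tail (Suc m) (Suc k) (c * t))"
        unfolding \<Lambda>\<theta> by simp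
      moreover have "\<Lambda> * V t - \<Lambda> * exp_tail r I (Suc k) t -
          (\<Lambda> * \<theta>) * (hom_tail m k (c * t) - hom_tail (Suc m) (Suc k) (c * t)) =
          \<Lambda> * (V t - W t) - \<Lambda> * D t"
        by (simp add: D_def W_def delayed_tail_def algebra_simps)
      ultimately show ?thesis
        by (simp only:)
    qed
    have dE: "(E has_real_derivative \<Lambda> * exp (\<Lambda> * t) * (V t - W t)) (at t)" for t
      unfolding E_def by (rule derivative_eq_intros dD refl)+ (simp add: algebra_simps)
    have cross: "W b \<le> V b" if "0 < a" "a < b" "W a \<le> V a" for a b
    proof (cases k)
      case 0
      \<comment> \<open>Nothing remains to wait for in the heterogeneous sample: \<open>V\<close> vanishes, while \<open>W\<close> does
        not because of the delay.\<close>
      have "0 < hom_tail (Suc m) (Suc 0) (c * a)"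
        using that Suc.prems by (intro hom_tail_between) simp_all
      then have "V a < W a"
        using 0 \<theta> by (simp add: V_def W_def delayed_tail_def)
      then show ?thesis using that by simp
    next
      case (Suc j)
      then obtain l where l: "m = Suc l" "j \<le> l"
        using m by (cases m) auto
      have between: "0 < exp_tail r (I - {i}) k a" "exp_tail r (I - {i}) k a < 1" if "i \<in> I" for i
        using exp_tail_between[of "I - {i}" r a k] Suc.prems that \<open>0 < a\<close> card_rem[OF that] Suc m
        by auto
      have "delayed_tail (1 - \<theta>) (Suc l) (Suc j) (c * b) \<le>
          (\<Sum>i\<in>I. r i / \<Lambda> * exp_tail r (I - {i}) k b)"
      proof (rule mixture_crossing[where x = a and v = "\<lambda>i. exp_tail r (I - {i}) k a"])
        show "(\<Sum>i\<in>I. r i / \<Lambda>) = 1"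
          using \<Lambda> by (simp add: sum_divide_distrib[symmetric] \<Lambda>_def)
        show "hom_tail (Suc l) (Suc j) (c' * b) \<le> exp_tail r (I - {i}) k b"
          if "i \<in> I" "0 < c'" "hom_tail (Suc l) (Suc j) (c' * a) \<le> exp_tail r (I - {i}) k a" for i c'
          using Suc.IH[of "I - {i}" c' a b] that \<open>0 < a\<close> \<open>a < b\<close> Suc.prems card_rem[OF that(1)] l m Suc
          by simp
        show "delayed_tail (1 - \<theta>) (Suc l) (Suc j) (c * a) \<le>
            (\<Sum>i\<in>I. r i / \<Lambda> * exp_tail r (I - {i}) k a)"
          using that by (simp add: W_def V_def l Suc)
        show "0 \<le> r i / \<Lambda>" if "i \<in> I" for i
          using Suc.prems(2)[OF that] \<Lambda> by simp
      qed (use Suc.prems l \<theta> that between in auto)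
      then show ?thesis
        by (simp add: W_def V_def l Suc)
    qed
    have Ex: "0 \<le> E x"
      using Suc.prems(8) m by (simp add: E_def D_def)
    \<comment> \<open>If \<open>V - W\<close> were negative at \<open>x\<close>, it would have been so ever since 0, and \<open>E\<close> would have
      decreased from 0 to a negative value.\<close>
    have "W x \<le> V x"
    proof (rule ccontr)
      assume "\<not> W x \<le> V x"
      then have neg: "V t < W t" if "0 < t" "t \<le> x" for t
        using cross[of t x] that by force
      obtain z where "0 < z" "z < x" "E x - E 0 = (x - 0) * (\<Lambda> * exp (\<Lambda> * z) * (V z - W z))"
        using MVT2[of 0 x E "\<lambda>t. \<Lambda> * exp (\<Lambda> * t) * (V t - W t)", OF Suc.prems(6) dE] by auto
      moreover have "E 0 = 0"
        using Suc.prems(1) hom_tail_eq_exp_tail[of "Suc m" "Suc k" 0] by (simp add: E_def D_def)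
      moreover have "\<Lambda> * exp (\<Lambda> * z) * (V z - W z) < 0"
        using neg[of z] calculation \<Lambda> by (intro mult_pos_neg) simp_all
      ultimately have "E x < 0"
        using Suc.prems by (simp add: mult_pos_neg)
      then show False using Ex by simp
    qed
    have "E x \<le> E y"
    proof (rule DERIV_nonneg_imp_nondecreasing[of x y E])
      fix t assume "x \<le> t" "t \<le> y"
      then have "W t \<le> V t"
        using cross[of x t] \<open>W x \<le> V x\<close> Suc.prems by (cases "x = t") auto
      then have "0 \<le> \<Lambda> * exp (\<Lambda> * t) * (V t - W t)"
        using \<Lambda> by simp
      then show "\<exists>d. (E has_real_derivative d) (at t) \<and> 0 \<le> d"
        using dE by blast
    qed (use Suc.prems in simp)
    then have "0 \<le> E y" using Ex by simp
    then show ?thesis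
      using m by (simp add: E_def D_def zero_le_mult_iff)
  qed
qed

section \<open>The distribution of order statistics\<close>

lemma sorted_nth_le_iff:
  fixes ys :: "'a::linorder list"
  assumes "sorted ys" "j < length ys"
  shows "ys ! j \<le> x \<longleftrightarrow> j < length (filter (\<lambda>y. y \<le> x) ys)"
  using assms
proof (induction ys arbitrary: j)
  case (Cons y ys)
  show ?case
  proof (cases "y \<le> x")
    case True
    then show ?thesis using Cons by (cases j) auto
  next
    case False
    then have "x < z" if "z \<in> set (y # ys)" for z
      using that Cons.prems by (auto simp: not_le)
    then have "filter (\<lambda>z. z \<le> x) (y # ys) = []" "x < (y # ys) ! j"
      using Cons.prems(2) nth_mem[OF Cons.prems(2)] by (auto simp: filter_empty_conv not_le simp del: filter.simps)
    then show ?thesis by simp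
  qed
qed simp

lemma order_stat_le_iff:
  assumes "1 \<le> k" "k \<le> n"
  shows "order_stat X n k \<omega> \<le> x \<longleftrightarrow> k \<le> card {i \<in> {1..n}. X i \<omega> \<le> x}"
proof -
  let ?xs = "map (\<lambda>i. X i \<omega>) [1..<Suc n]"
  have "order_stat X n k \<omega> \<le> x \<longleftrightarrow> k - 1 < length (filter (\<lambda>y. y \<le> x) (sort ?xs))"
    unfolding order_stat_def using assms by (intro sorted_nth_le_iff) (simp_all add: less_Suc_eq_le)
  also have "length (filter (\<lambda>y. y \<le> x) (sort ?xs)) = length (filter (\<lambda>y. y \<le> x) ?xs)"
    by (metis mset_filter mset_sort size_mset)
  also have "\<dots> = card {i \<in> {1..n}. X i \<omega> \<le> x}"
    by (simp add: filter_map o_def distinct_length_filter del: upt_Suc)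
      (rule arg_cong[where f = card], auto)
  finally show ?thesis
    using assms by auto
qed

context prob_space
begin

text \<open>
  The event is split according to the exact set \<open>J\<close> of variables that do not exceed \<open>x\<close>, so that
  independence applies to each piece.
\<close>

lemma order_stat_le_event:
  assumes "1 \<le> k" "k \<le> n"
  shows "{\<omega> \<in> space M. order_stat X n k \<omega> \<le> x} =
    (\<Union>J\<in>{J. J \<subseteq> {1..n} \<and> k \<le> card J}.
      \<Inter>i\<in>{1..n}. X i -` (if i \<in> J then {..x} else {x<..}) \<inter> space M)"
    (is "?L = ?R")
proof (intro equalityI subsetI)
  fix \<omega> assume "\<omega> \<in> ?L"
  then show "\<omega> \<in> ?R"
    unfolding order_stat_le_iff[OF assms]
    by (intro UN_I[of "{i \<in> {1..n}. X i \<omega> \<le> x}"]) auto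
next
  fix \<omega> assume "\<omega> \<in> ?R"
  then obtain J where J: "J \<subseteq> {1..n}" "k \<le> card J"
    "\<And>i. i \<in> {1..n} \<Longrightarrow> \<omega> \<in> X i -` (if i \<in> J then {..x} else {x<..}) \<inter> space M"
    by blast
  have "1 \<in> {1..n}" using assms by simp
  moreover have "J \<subseteq> {i \<in> {1..n}. X i \<omega> \<le> x}"
    using J(1,3) by fastforce
  then have "card J \<le> card {i \<in> {1..n}. X i \<omega> \<le> x}"
    by (intro card_mono) simp_all
  ultimately show "\<omega> \<in> ?L"
    unfolding order_stat_le_iff[OF assms] using J(2) J(3)[of 1] by auto
qed

lemma order_stat_measurable:
  assumes "1 \<le> k" "k \<le> n" "\<And>i. i \<in> {1..n} \<Longrightarrow> X i \<in> borel_measurable M"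
  shows "order_stat X n k \<in> borel_measurable M"
  unfolding borel_measurable_iff_le order_stat_le_event[OF assms(1,2)]
  using assms by (intro allI sets.finite_UN sets.finite_INT measurable_sets[OF assms(3)]) auto

lemma prob_order_stat_le:
  assumes k: "1 \<le> k" "k \<le> n"
    and indep: "indep_vars (\<lambda>_. borel) X {1..n}"
  shows "prob {\<omega> \<in> space M. order_stat X n k \<omega> \<le> x} =
    1 - fewer_than (\<lambda>i. prob {\<omega> \<in> space M. X i \<omega> \<le> x}) {1..n} k"
proof -
  let ?I = "{1..n}" and ?p = "\<lambda>i. prob {\<omega> \<in> space M. X i \<omega> \<le> x}"
  let ?A = "\<lambda>J i. if i \<in> J then {..x} else {x<..}"
  define E where "E = (\<lambda>J. \<Inter>i\<in>?I. X i -` ?A J i \<inter> space M)"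
  have meas: "X i \<in> borel_measurable M" if "i \<in> ?I" for i
    using indep that by (auto simp: indep_vars_def)
  have ne: "1 \<in> ?I"
    using k by simp
  have E_sets: "E J \<in> sets M" for J
    unfolding E_def using ne by (intro sets.finite_INT measurable_sets[OF meas]) auto
  have prob_A: "prob (X i -` ?A J i \<inter> space M) = (if i \<in> J then ?p i else 1 - ?p i)"
    if "i \<in> ?I" for i J
  proof -
    have le: "{\<omega> \<in> space M. X i \<omega> \<le> x} \<in> events"
      using meas[OF that] by measurable
    have "X i -` {..x} \<inter> space M = {\<omega> \<in> space M. X i \<omega> \<le> x}"
      "X i -` {x<..} \<inter> space M = space M - {\<omega> \<in> space M. X i \<omega> \<le> x}"
      by auto
    then show ?thesis
      using prob_compl[OF le] by auto
  qed
  have prob_E: "prob (E J) = (\<Prod>i\<in>J. ?p i) * (\<Prod>i\<in>?I - J. 1 - ?p i)" if "J \<subseteq> ?I" for J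
  proof -
    have "prob (E J) = (\<Prod>i\<in>?I. prob (X i -` ?A J i \<inter> space M))"
      unfolding E_def using ne by (intro indep_varsD[OF indep]) auto
    also have "\<dots> = (\<Prod>i\<in>?I. if i \<in> J then ?p i else 1 - ?p i)"
      using prob_A by (intro prod.cong refl) simp
    also have "\<dots> = (\<Prod>i\<in>J. ?p i) * (\<Prod>i\<in>?I - J. 1 - ?p i)"
      using that by (subst prod.If_cases) (auto simp: Int_absorb1 Diff_eq intro!: arg_cong2[where f = "(*)"] prod.cong)
    finally show ?thesis .
  qed
  have disj: "disjoint_family_on E {J. J \<subseteq> ?I \<and> k \<le> card J}"
    unfolding disjoint_family_on_def
  proof (intro ballI impI)
    fix J J' assume J: "J \<in> {J. J \<subseteq> ?I \<and> k \<le> card J}" "J' \<in> {J. J \<subseteq> ?I \<and> k \<le> card J}" "J \<noteq> J'"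
    \<comment> \<open>the outcome determines the index set\<close>
    have pat: "K = {i \<in> ?I. X i \<omega> \<le> x}" if "\<omega> \<in> E K" "K \<subseteq> ?I" for K \<omega>
      using that by (fastforce simp: E_def split: if_splits)
    show "E J \<inter> E J' = {}"
      using pat[of _ J] pat[of _ J'] J by blast
  qed
  have "prob {\<omega> \<in> space M. order_stat X n k \<omega> \<le> x} = prob (\<Union>J\<in>{J. J \<subseteq> ?I \<and> k \<le> card J}. E J)"
    unfolding order_stat_le_event[OF k] E_def ..
  also have "\<dots> = (\<Sum>J | J \<subseteq> ?I \<and> k \<le> card J. prob (E J))"
    using E_sets disj by (intro finite_measure_finite_Union) auto
  also have "\<dots> = 1 - fewer_than ?p ?I k"
    by (subst fewer_than_compl) (auto simp: prob_E)
  finally show ?thesis .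
qed

lemma dist_fun_order_stat_exponential:
  assumes k: "1 \<le> k" "k \<le> n"
    and indep: "indep_vars (\<lambda>_. borel) X {1..n}"
    and pos: "\<And>i. i \<in> {1..n} \<Longrightarrow> 0 < r i"
    and exp: "\<And>i. i \<in> {1..n} \<Longrightarrow> distributed M lborel (X i) (exponential_density (r i))"
    and "0 \<le> x"
  shows "dist_fun M (order_stat X n k) x = 1 - exp_tail r {1..n} k x"
proof -
  have "order_stat X n k \<in> borel_measurable M"
    using indep by (intro order_stat_measurable k) (auto simp: indep_vars_def)
  then have "dist_fun M (order_stat X n k) x = prob {\<omega> \<in> space M. order_stat X n k \<omega> \<le> x}"
    unfolding dist_fun_def cdf_def
    by (subst measure_distr) (auto intro!: arg_cong[where f = prob])
  also have "\<dots> = 1 - fewer_than (\<lambda>i. prob {\<omega> \<in> space M. X i \<omega> \<le> x}) {1..n} k"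
    by (rule prob_order_stat_le[OF k indep])
  also have "fewer_than (\<lambda>i. prob {\<omega> \<in> space M. X i \<omega> \<le> x}) {1..n} k = exp_tail r {1..n} k x"
    unfolding exp_tail_def
    using exponential_distributedD_le[OF exp \<open>0 \<le> x\<close> pos]
    by (intro fewer_than_cong) (simp_all add: mult.commute)
  finally show ?thesis .
qed

lemma dist_fun_nonpos_eq_0:
  assumes U: "U \<in> borel_measurable M" and "dist_fun M U 0 = 0"
  shows "x \<le> 0 \<Longrightarrow> dist_fun M U x = 0" "AE \<omega> in M. 0 < U \<omega>"
proof -
  have eq: "dist_fun M U x = prob {\<omega> \<in> space M. U \<omega> \<le> x}" for x
    unfolding dist_fun_def cdf_def
    using U by (subst measure_distr) (auto intro!: arg_cong[where f = prob])
  have sets: "{\<omega> \<in> space M. U \<omega> \<le> x} \<in> events" for x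
    using U by measurable
  show "AE \<omega> in M. 0 < U \<omega>"
    using assms(2) sets[of 0] unfolding eq
    by (intro AE_I[of _ _ "{\<omega> \<in> space M. U \<omega> \<le> 0}"]) (auto simp: emeasure_eq_measure)
  show "dist_fun M U x = 0" if "x \<le> 0"
  proof -
    have "dist_fun M U x \<le> dist_fun M U 0"
      unfolding eq using that sets by (intro finite_measure_mono) auto
    then show ?thesis
      using assms(2) by (simp add: eq antisym measure_nonneg)
  qed
qed

end

section \<open>From single crossing to the star order\<close>

text \<open>
  The hypothesis is single crossing stated for the sets that define the inverses: if \<open>z\<close> is a
  candidate for the infimum at \<open>F y\<close>, then \<open>x * z / y\<close> is one at \<open>F x\<close>. Working
  with candidates treats finite and infinite values of the inverse alike.
\<close>

lemma rc_inverse_ratio_mono: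
  assumes "\<And>x y z. 0 < x \<Longrightarrow> x < y \<Longrightarrow> F y < G z \<Longrightarrow> F x < G (x * z / y)"
  shows "mono_on {0<..} (\<lambda>x. rc_inverse G (F x) / ereal x)"
proof (rule mono_onI)
  fix x y :: real assume "x \<in> {0<..}" "y \<in> {0<..}" "x \<le> y"
  then have pos: "0 < x" "0 < y" by auto
  show "rc_inverse G (F x) / ereal x \<le> rc_inverse G (F y) / ereal y"
  proof (cases "x = y")
    case False
    then have "x < y" using \<open>x \<le> y\<close> by simp
    have "ereal y * (rc_inverse G (F x) / ereal x) \<le> rc_inverse G (F y)"
      unfolding rc_inverse_def[of G "F y"]
    proof (rule INF_greatest)
      fix z assume "z \<in> {z. F y < G z}"
      then have "F x < G (x * z / y)"
        using assms[OF pos(1) \<open>x < y\<close>] by simp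
      then have "rc_inverse G (F x) \<le> ereal (x * z / y)"
        unfolding rc_inverse_def by (intro INF_lower) simp
      then have "rc_inverse G (F x) / ereal x \<le> ereal (z / y)"
        using pos by (subst ereal_divide_le_pos) simp_all
      then have "ereal y * (rc_inverse G (F x) / ereal x) \<le> ereal y * ereal (z / y)"
        using pos by (intro ereal_mult_left_mono) simp_all
      then show "ereal y * (rc_inverse G (F x) / ereal x) \<le> ereal z"
        using pos by simp
    qed
    then show ?thesis
      using pos by (subst ereal_le_divide_pos) simp_all
  qed simp
qed

theorem theorem2:
  fixes M :: "'a measure" and N :: "'b measure"
    and X :: "nat \<Rightarrow> 'a \<Rightarrow> real" and Y :: "nat \<Rightarrow> 'b \<Rightarrow> real"
    and rate :: "nat \<Rightarrow> real" and \<gamma> :: real and n k :: nat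
  assumes "prob_space M" and "prob_space N"
    and "1 \<le> n" and "1 \<le> k" and "k \<le> n"
    and "\<And>i. i \<in> {1..n} \<Longrightarrow> 0 < rate i" and "0 < \<gamma>"
    and "prob_space.indep_vars M (\<lambda>_. borel) X {1..n}"
    and "\<And>i. i \<in> {1..n} \<Longrightarrow> distributed M lborel (X i) (exponential_density (rate i))"
    and "prob_space.indep_vars N (\<lambda>_. borel) Y {1..n}"
    and "\<And>i. i \<in> {1..n} \<Longrightarrow> distributed N lborel (Y i) (exponential_density \<gamma>)"
  shows "star_le N (order_stat Y n k) M (order_stat X n k)"
proof -
  interpret M: prob_space M by fact
  interpret N: prob_space N by fact
  let ?F = "dist_fun N (order_stat Y n k)" and ?G = "dist_fun M (order_stat X n k)"
  have F: "?F x = 1 - hom_tail n k (\<gamma> * x)" if "0 \<le> x" for x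
    using N.dist_fun_order_stat_exponential[OF assms(4,5,10) assms(7,11) that]
    by (simp add: exp_tail_const)
  have G: "?G x = 1 - exp_tail rate {1..n} k x" if "0 \<le> x" for x
    by (rule M.dist_fun_order_stat_exponential[OF assms(4,5,8,6,9) that])
  have F0: "?F 0 = 0" and G0: "?G 0 = 0"
    using assms(4) F[of 0] G[of 0] hom_tail_eq_exp_tail[of n k 0] by (cases k; simp)+
  have Y: "order_stat Y n k \<in> borel_measurable N"
    using assms(10) by (intro N.order_stat_measurable assms(4,5)) (auto simp: N.indep_vars_def)
  have X: "order_stat X n k \<in> borel_measurable M"
    using assms(8) by (intro M.order_stat_measurable assms(4,5)) (auto simp: M.indep_vars_def)
  have cross: "?F x < ?G (x * z / y)" if "0 < x" "x < y" "?F y < ?G z" for x y z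
  proof -
    have "0 \<le> ?F y"
      by (simp add: dist_fun_def cdf_def)
    then have z: "0 < z"
      using that(3) M.dist_fun_nonpos_eq_0(1)[OF X G0, of z] by (cases "0 < z") auto
    show ?thesis
    proof (rule ccontr)
      assume "\<not> ?thesis"
      \<comment> \<open>The points \<open>x * z / y < z\<close> correspond to \<open>x < y\<close> under the factor \<open>y / z\<close>, so the
        homogeneous sample is to be taken with rate \<open>\<gamma> * y / z\<close>.\<close>
      then have "hom_tail n k (\<gamma> * y / z * (x * z / y)) \<le> exp_tail rate {1..n} k (x * z / y)"
        using that z F[of x] G[of "x * z / y"] by simp
      then have "hom_tail n k (\<gamma> * y / z * z) \<le> exp_tail rate {1..n} k z"
        using exp_tail_crossing[of "{1..n}" rate k "\<gamma> * y / z" "x * z / y" z] assms that z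
        by (simp add: field_simps)
      then show False
        using that z F[of y] G[of z] by simp
    qed
  qed
  show ?thesis
    unfolding star_le_def
    by (intro conjI X Y M.dist_fun_nonpos_eq_0(2)[OF X G0] N.dist_fun_nonpos_eq_0(2)[OF Y F0]
        rc_inverse_ratio_mono cross)
qed

end
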